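(* Let $\varphi$ be a calibration of degree $l$ on a Riemannian manifold $(M,g)$ and let $L\subset M$ be a $\varphi$-calibrated submanifold. Then $\mathrm{pr}\circ\hat\varphi_{|L}=0\in\Omega^*(L,NL)$.
   Context: A calibration is a closed differential form of comass one; an oriented $l$-dimensional submanifold $L$ is $\varphi$-calibrated if $\varphi$ restricts to its Riemannian volume form. $NL=TM_{|L}/TL$ is the normal bundle (identified with the orthogonal complement of $TL$) and $\mathrm{pr}:TM_{|L}\to NL$ is the projection. $\hat\varphi=\sum_i(\iota_{e_i}\varphi)\otimes e_i\in\Omega^{l-1}(M,TM)$, with $(e_i)$ an orthonormal basis of $T_xM$; $\hat\varphi_{|L}$ denotes its restriction to vectors tangent to $L$. *)

theory Defs
  imports "HOL-Analysis.Analysis"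
begin

section \<open>Smooth manifolds\<close>

fun differentiable_upto :: "nat \<Rightarrow> 'e::real_normed_vector set \<Rightarrow> ('e \<Rightarrow> 'f::real_normed_vector) \<Rightarrow> bool" where
  "differentiable_upto 0 S f \<longleftrightarrow> continuous_on S f"
| "differentiable_upto (Suc k) S f \<longleftrightarrow>
     (\<forall>p\<in>S. f differentiable (at p)) \<and>
     (\<forall>v. differentiable_upto k S (\<lambda>p. frechet_derivative f (at p) v))"

text \<open>Only used on open sets \<open>S\<close>.\<close>

definition smooth_on :: "'e::real_normed_vector set \<Rightarrow> ('e \<Rightarrow> 'f::real_normed_vector) \<Rightarrow> bool" where
  "smooth_on S f \<longleftrightarrow> (\<forall>k. differentiable_upto k S f)"

text \<open>A chart is a pair of its domain and its coordinate map; the values of the coordinate map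
  outside the domain are irrelevant.\<close>

type_synonym ('a, 'e) chart = "'a set \<times> ('a \<Rightarrow> 'e)"

definition chart_image :: "('a, 'e) chart \<Rightarrow> 'e set" where
  "chart_image c = snd c ` fst c"

definition chart_inv :: "('a, 'e) chart \<Rightarrow> 'e \<Rightarrow> 'a" where
  "chart_inv c = inv_into (fst c) (snd c)"

definition transition :: "('a, 'e) chart \<Rightarrow> ('a, 'e) chart \<Rightarrow> 'e \<Rightarrow> 'e" where
  "transition c d = snd d \<circ> chart_inv c"

definition is_chart :: "'a topology \<Rightarrow> ('a, 'e::euclidean_space) chart \<Rightarrow> bool" where
  "is_chart X c \<longleftrightarrow> openin X (fst c) \<and> open (chart_image c) \<and>
     homeomorphic_map (subtopology X (fst c)) (top_of_set (chart_image c)) (snd c)"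

definition compatible_charts :: "('a, 'e::euclidean_space) chart \<Rightarrow> ('a, 'e) chart \<Rightarrow> bool" where
  "compatible_charts c d \<longleftrightarrow>
     smooth_on (snd c ` (fst c \<inter> fst d)) (transition c d) \<and>
     smooth_on (snd d ` (fst c \<inter> fst d)) (transition d c)"

definition second_countable_space :: "'a topology \<Rightarrow> bool" where
  "second_countable_space X \<longleftrightarrow>
     (\<exists>\<B>. countable \<B> \<and> (\<forall>V\<in>\<B>. openin X V) \<and>
          (\<forall>U x. openin X U \<and> x \<in> U \<longrightarrow> (\<exists>V\<in>\<B>. x \<in> V \<and> V \<subseteq> U)))"

text \<open>\<open>A\<close> is the maximal atlas (the smooth structure), so that it contains all charts of the
  manifold, in particular those adapted to a submanifold. The manifold has dimension \<open>DIM('e)\<close>.\<close>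

definition smooth_manifold :: "'a topology \<Rightarrow> ('a, 'e::euclidean_space) chart set \<Rightarrow> bool" where
  "smooth_manifold X A \<longleftrightarrow>
     Hausdorff_space X \<and> second_countable_space X \<and>
     (\<forall>c\<in>A. is_chart X c) \<and>
     topspace X = (\<Union>c\<in>A. fst c) \<and>
     (\<forall>c\<in>A. \<forall>d\<in>A. compatible_charts c d) \<and>
     (\<forall>c. is_chart X c \<and> (\<forall>d\<in>A. compatible_charts c d) \<longrightarrow> c \<in> A)"


section \<open>Tangent vectors\<close>

text \<open>A tangent vector is the family of its components in the charts; the components in different
  charts around the base point are related by the derivative of the transition map. The type of
  all families of components is a real vector space, and the tangent spaces are
  subspaces of it. The base point is not part of the data of a vector.\<close>

typedef ('a, 'e) tvec = "UNIV :: (('a, 'e) chart \<Rightarrow> 'e) set"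
  morphisms components Tvec ..

setup_lifting type_definition_tvec

instantiation tvec :: (type, real_vector) real_vector
begin

lift_definition zero_tvec :: "('a, 'b) tvec" is "\<lambda>c. 0" .
lift_definition plus_tvec :: "('a, 'b) tvec \<Rightarrow> ('a, 'b) tvec \<Rightarrow> ('a, 'b) tvec"
  is "\<lambda>v w c. v c + w c" .
lift_definition uminus_tvec :: "('a, 'b) tvec \<Rightarrow> ('a, 'b) tvec" is "\<lambda>v c. - v c" .
lift_definition minus_tvec :: "('a, 'b) tvec \<Rightarrow> ('a, 'b) tvec \<Rightarrow> ('a, 'b) tvec"
  is "\<lambda>v w c. v c - w c" .
lift_definition scaleR_tvec :: "real \<Rightarrow> ('a, 'b) tvec \<Rightarrow> ('a, 'b) tvec"
  is "\<lambda>r v c. r *\<^sub>R v c" .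

instance
  by standard (transfer; simp add: algebra_simps)+

end

definition tangent_space :: "('a, 'e::euclidean_space) chart set \<Rightarrow> 'a \<Rightarrow> ('a, 'e) tvec set" where
  "tangent_space A x = {v.
     (\<forall>c\<in>A. \<forall>d\<in>A. x \<in> fst c \<and> x \<in> fst d \<longrightarrow>
        components v d = frechet_derivative (transition c d) (at (snd c x)) (components v c)) \<and>
     (\<forall>c. \<not> (c \<in> A \<and> x \<in> fst c) \<longrightarrow> components v c = 0)}"

text \<open>The tangent vector at \<open>x\<close> whose component in the chart \<open>c\<close> is \<open>u\<close>.\<close>

definition coord_vec ::
    "('a, 'e::euclidean_space) chart set \<Rightarrow> ('a, 'e) chart \<Rightarrow> 'a \<Rightarrow> 'e \<Rightarrow> ('a, 'e) tvec" where
  "coord_vec A c x u = Tvec (\<lambda>d. if d \<in> A \<and> x \<in> fst d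
     then frechet_derivative (transition c d) (at (snd c x)) u else 0)"


section \<open>Riemannian metrics\<close>

type_synonym ('a, 'e) metric = "'a \<Rightarrow> ('a, 'e) tvec \<Rightarrow> ('a, 'e) tvec \<Rightarrow> real"

definition inner_product_on :: "'v::real_vector set \<Rightarrow> ('v \<Rightarrow> 'v \<Rightarrow> real) \<Rightarrow> bool" where
  "inner_product_on V b \<longleftrightarrow>
     (\<forall>u\<in>V. \<forall>v\<in>V. \<forall>w\<in>V. \<forall>r s. b (r *\<^sub>R u + s *\<^sub>R v) w = r * b u w + s * b v w) \<and>
     (\<forall>u\<in>V. \<forall>v\<in>V. b u v = b v u) \<and>
     (\<forall>v\<in>V. v \<noteq> 0 \<longrightarrow> b v v > 0)"

definition riemannian_metric ::
    "'a topology \<Rightarrow> ('a, 'e::euclidean_space) chart set \<Rightarrow> ('a, 'e) metric \<Rightarrow> bool" where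
  "riemannian_metric X A g \<longleftrightarrow>
     (\<forall>x\<in>topspace X. inner_product_on (tangent_space A x) (g x)) \<and>
     (\<forall>c\<in>A. \<forall>u w. smooth_on (chart_image c)
        (\<lambda>p. g (chart_inv c p) (coord_vec A c (chart_inv c p) u) (coord_vec A c (chart_inv c p) w)))"

definition orthonormal_list :: "('v \<Rightarrow> 'v \<Rightarrow> real) \<Rightarrow> 'v list \<Rightarrow> bool" where
  "orthonormal_list b es \<longleftrightarrow>
     (\<forall>i<length es. \<forall>j<length es. b (es ! i) (es ! j) = (if i = j then 1 else 0))"

definition orthonormal_basis :: "'v::real_vector set \<Rightarrow> ('v \<Rightarrow> 'v \<Rightarrow> real) \<Rightarrow> 'v list \<Rightarrow> bool" where
  "orthonormal_basis V b es \<longleftrightarrow> orthonormal_list b es \<and> set es \<subseteq> V \<and> V \<subseteq> span (set es)"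


section \<open>Differential forms and calibrations\<close>

text \<open>A form of degree \<open>k\<close> assigns to a point a function of the list of its \<open>k\<close> arguments.\<close>

type_synonym ('a, 'e) form = "'a \<Rightarrow> ('a, 'e) tvec list \<Rightarrow> real"

definition alternating_on :: "'v::real_vector set \<Rightarrow> nat \<Rightarrow> ('v list \<Rightarrow> real) \<Rightarrow> bool" where
  "alternating_on V k f \<longleftrightarrow>
     (\<forall>vs i. set vs \<subseteq> V \<and> length vs = k \<and> i < k \<longrightarrow>
        (\<forall>v\<in>V. \<forall>w\<in>V. \<forall>r s.
           f (vs[i := r *\<^sub>R v + s *\<^sub>R w]) = r * f (vs[i := v]) + s * f (vs[i := w]))) \<and>
     (\<forall>vs i j. set vs \<subseteq> V \<and> length vs = k \<and> i < j \<and> j < k \<and> vs ! i = vs ! j \<longrightarrow> f vs = 0)"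

text \<open>The local representation of a form in a chart, as a function of the coordinates \<open>p\<close> and
  of constant coordinate vector fields \<open>us\<close>.\<close>

definition local_rep ::
    "('a, 'e::euclidean_space) chart set \<Rightarrow> ('a, 'e) form \<Rightarrow> ('a, 'e) chart \<Rightarrow> 'e \<Rightarrow> 'e list \<Rightarrow> real" where
  "local_rep A \<phi> c p us = \<phi> (chart_inv c p) (map (coord_vec A c (chart_inv c p)) us)"

definition differential_form ::
    "'a topology \<Rightarrow> ('a, 'e::euclidean_space) chart set \<Rightarrow> nat \<Rightarrow> ('a, 'e) form \<Rightarrow> bool" where
  "differential_form X A k \<phi> \<longleftrightarrow>
     (\<forall>x\<in>topspace X. alternating_on (tangent_space A x) k (\<phi> x)) \<and>
     (\<forall>c\<in>A. \<forall>us. length us = k \<longrightarrow> smooth_on (chart_image c) (\<lambda>p. local_rep A \<phi> c p us))"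

text \<open>The exterior derivative in a chart, evaluated on the constant vector fields \<open>us\<close>
  (whose Lie brackets vanish): the \<open>i\<close>-th argument is removed and used for differentiation.\<close>

definition local_ext_deriv ::
    "('a, 'e::euclidean_space) chart set \<Rightarrow> ('a, 'e) form \<Rightarrow> ('a, 'e) chart \<Rightarrow> 'e \<Rightarrow> 'e list \<Rightarrow> real" where
  "local_ext_deriv A \<phi> c p us =
     (\<Sum>i<length us. (-1) ^ i *
        frechet_derivative (\<lambda>q. local_rep A \<phi> c q (take i us @ drop (Suc i) us)) (at p) (us ! i))"

definition closed_form :: "('a, 'e::euclidean_space) chart set \<Rightarrow> nat \<Rightarrow> ('a, 'e) form \<Rightarrow> bool" where
  "closed_form A k \<phi> \<longleftrightarrow>
     (\<forall>c\<in>A. \<forall>p\<in>chart_image c. \<forall>us. length us = Suc k \<longrightarrow> local_ext_deriv A \<phi> c p us = 0)"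

text \<open>The comass is the supremum over all points and all unit simple \<open>k\<close>-vectors
  \<open>e\<^sub>1 \<and> \<dots> \<and> e\<^sub>k\<close> with \<open>e\<^sub>1, \<dots>, e\<^sub>k\<close> orthonormal. In \<open>ennreal\<close> the supremum always exists,
  and it is \<open>0\<close> over the empty set.\<close>

definition comass ::
    "'a topology \<Rightarrow> ('a, 'e::euclidean_space) chart set \<Rightarrow> ('a, 'e) metric \<Rightarrow> nat \<Rightarrow> ('a, 'e) form \<Rightarrow> ennreal" where
  "comass X A g k \<phi> =
     (SUP x\<in>topspace X.
        SUP es\<in>{es. set es \<subseteq> tangent_space A x \<and> length es = k \<and> orthonormal_list (g x) es}.
          ennreal \<bar>\<phi> x es\<bar>)"

definition calibration ::
    "'a topology \<Rightarrow> ('a, 'e::euclidean_space) chart set \<Rightarrow> ('a, 'e) metric \<Rightarrow> nat \<Rightarrow> ('a, 'e) form \<Rightarrow> bool" where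
  "calibration X A g l \<phi> \<longleftrightarrow>
     differential_form X A l \<phi> \<and> closed_form A l \<phi> \<and> comass X A g l \<phi> = 1"


section \<open>Oriented submanifolds\<close>

text \<open>A chart in which \<open>L\<close> is given by a linear subspace \<open>S\<close>.\<close>

definition slice_chart ::
    "('a, 'e::euclidean_space) chart set \<Rightarrow> 'a set \<Rightarrow> ('a, 'e) chart \<Rightarrow> 'e set \<Rightarrow> bool" where
  "slice_chart A L c S \<longleftrightarrow>
     c \<in> A \<and> subspace S \<and> snd c ` (fst c \<inter> L) = chart_image c \<inter> S"

definition submanifold ::
    "'a topology \<Rightarrow> ('a, 'e::euclidean_space) chart set \<Rightarrow> nat \<Rightarrow> 'a set \<Rightarrow> bool" where
  "submanifold X A l L \<longleftrightarrow>
     L \<subseteq> topspace X \<and> (\<forall>x\<in>L. \<exists>c S. slice_chart A L c S \<and> x \<in> fst c \<and> dim S = l)"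

definition sub_tangent_space ::
    "('a, 'e::euclidean_space) chart set \<Rightarrow> 'a set \<Rightarrow> 'a \<Rightarrow> ('a, 'e) tvec set" where
  "sub_tangent_space A L x =
     {v \<in> tangent_space A x. \<exists>c S. slice_chart A L c S \<and> x \<in> fst c \<and> components v c \<in> S}"

text \<open>An orientation is represented by a nowhere vanishing continuous form \<open>\<mu>\<close> of top degree
  on \<open>L\<close>; a basis \<open>es\<close> of \<open>T\<^sub>xL\<close> is positively oriented iff \<open>\<mu> x es > 0\<close>. Only the sign of
  \<open>\<mu>\<close> matters.\<close>

definition orientation_form ::
    "('a, 'e::euclidean_space) chart set \<Rightarrow> nat \<Rightarrow> 'a set \<Rightarrow> ('a, 'e) form \<Rightarrow> bool" where
  "orientation_form A l L \<mu> \<longleftrightarrow>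
     (\<forall>x\<in>L. alternating_on (sub_tangent_space A L x) l (\<mu> x) \<and>
        (\<exists>vs. set vs \<subseteq> sub_tangent_space A L x \<and> length vs = l \<and> \<mu> x vs \<noteq> 0)) \<and>
     (\<forall>c S us. slice_chart A L c S \<and> set us \<subseteq> S \<and> length us = l \<longrightarrow>
        continuous_on (snd c ` (fst c \<inter> L)) (\<lambda>p. local_rep A \<mu> c p us))"

text \<open>The Riemannian volume form is the top degree form with value \<open>1\<close> on positively oriented and
  hence \<open>-1\<close> on negatively oriented orthonormal bases. (Using the sign also covers degree \<open>0\<close>,
  where the empty list is the only basis.)\<close>

definition riemannian_volume_form ::
    "('a, 'e::euclidean_space) chart set \<Rightarrow> ('a, 'e) metric \<Rightarrow> nat \<Rightarrow> 'a set \<Rightarrow>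
      ('a, 'e) form \<Rightarrow> ('a, 'e) form \<Rightarrow> bool" where
  "riemannian_volume_form A g l L \<mu> \<omega> \<longleftrightarrow>
     (\<forall>x\<in>L. alternating_on (sub_tangent_space A L x) l (\<omega> x) \<and>
        (\<forall>es. orthonormal_basis (sub_tangent_space A L x) (g x) es \<longrightarrow> \<omega> x es = sgn (\<mu> x es)))"

text \<open>The values of \<open>\<phi>\<close> on vectors tangent to \<open>L\<close> form the volume form; as
  \<^const>\<open>riemannian_volume_form\<close> only evaluates on such vectors, no explicit restriction is
  needed.\<close>

definition calibrated_submanifold ::
    "'a topology \<Rightarrow> ('a, 'e::euclidean_space) chart set \<Rightarrow> ('a, 'e) metric \<Rightarrow> nat \<Rightarrow>
      ('a, 'e) form \<Rightarrow> 'a set \<Rightarrow> ('a, 'e) form \<Rightarrow> bool" where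
  "calibrated_submanifold X A g l \<phi> L \<mu> \<longleftrightarrow>
     submanifold X A l L \<and> orientation_form A l L \<mu> \<and> riemannian_volume_form A g l L \<mu> \<phi>"


section \<open>The normal bundle and the vector-valued form\<close>

text \<open>The fibre \<open>T\<^sub>xM / T\<^sub>xL\<close> of the normal bundle consists of the cosets of \<open>T\<^sub>xL\<close>.\<close>

definition normal_pr ::
    "('a, 'e::euclidean_space) chart set \<Rightarrow> 'a set \<Rightarrow> 'a \<Rightarrow> ('a, 'e) tvec \<Rightarrow> ('a, 'e) tvec set" where
  "normal_pr A L x v = (+) v ` sub_tangent_space A L x"

definition normal_zero ::
    "('a, 'e::euclidean_space) chart set \<Rightarrow> 'a set \<Rightarrow> 'a \<Rightarrow> ('a, 'e) tvec set" where
  "normal_zero A L x = normal_pr A L x 0"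

text \<open>The value does not depend on the chosen orthonormal basis of \<open>T\<^sub>xM\<close>.\<close>

definition hat_form ::
    "('a, 'e::euclidean_space) chart set \<Rightarrow> ('a, 'e) metric \<Rightarrow> ('a, 'e) form \<Rightarrow>
      'a \<Rightarrow> ('a, 'e) tvec list \<Rightarrow> ('a, 'e) tvec" where
  "hat_form A g \<phi> x vs =
     (let es = (SOME es. orthonormal_basis (tangent_space A x) (g x) es)
      in \<Sum>e\<leftarrow>es. \<phi> x (e # vs) *\<^sub>R e)"

end

theory Submission
  imports Defs "HOL-Combinatorics.Permutations"
begin

text \<open>
  Everything happens in a single tangent space \<open>V = T\<^sub>xM\<close>, with \<open>T = T\<^sub>xL\<close> and the alternating
  map \<open>f\<close> that \<open>\<phi>\<close> defines on \<open>V\<close>. The vector \<open>w = \<Sum>\<^sub>i f (e\<^sub>i, v\<^sub>2, \<dots>, v\<^sub>l) e\<^sub>i\<close> is the Riesz dual of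
  the functional \<open>v \<mapsto> f (v, v\<^sub>2, \<dots>, v\<^sub>l)\<close>, so its normal part vanishes as soon as
  \<open>f (n, v\<^sub>2, \<dots>, v\<^sub>l) = 0\<close> for all \<open>n\<close> orthogonal to \<open>T\<close> and all \<open>v\<^sub>2, \<dots>, v\<^sub>l\<close> in \<open>T\<close>.

  By multilinearity it suffices to take for \<open>v\<^sub>2, \<dots>, v\<^sub>l\<close> all but one member \<open>e\<close> of an orthonormal
  basis of \<open>T\<close>. Rotating \<open>e\<close> towards the unit normal \<open>n\<close> keeps the list orthonormal, so
  \<open>\<bar>cos \<theta> f (e, v\<^sub>2, \<dots>) + sin \<theta> f (n, v\<^sub>2, \<dots>)\<bar> \<le> 1\<close> for all \<open>\<theta>\<close> because the comass is \<open>1\<close>. As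
  \<open>L\<close> is calibrated, \<open>f (e, v\<^sub>2, \<dots>) = \<plusminus>1\<close>: the bound is attained at \<open>\<theta> = 0\<close>, and the coefficient of
  \<open>sin \<theta>\<close> must vanish (\<open>comass_first_variation\<close>).

  The argument needs \<open>T\<^sub>xM\<close> and \<open>T\<^sub>xL\<close> to be subspaces with orthonormal bases, that of \<open>T\<^sub>xL\<close> having
  \<open>l\<close> members. Both are images of coordinate spaces under the injective linear map
  \<open>coord_vec\<close> of a slice chart; for \<open>T\<^sub>xL\<close> this needs that transition maps between slice charts
  carry slices to slices to first order (\<open>slice_transition_derivative\<close>).
\<close>


section \<open>Orthonormal sets in a subspace with an inner product\<close>

definition orthonormal_set :: "('v \<Rightarrow> 'v \<Rightarrow> real) \<Rightarrow> 'v set \<Rightarrow> bool" where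
  "orthonormal_set b B \<longleftrightarrow> (\<forall>x\<in>B. \<forall>y\<in>B. b x y = (if x = y then 1 else 0))"

text \<open>A repeated entry \<open>e\<close> would have to satisfy both \<open>b e e = 1\<close> and \<open>b e e = 0\<close>, so orthonormal lists
  are enumerations of orthonormal sets.\<close>

lemma orthonormal_list_iff:
  "orthonormal_list b es \<longleftrightarrow> distinct es \<and> orthonormal_set b (set es)"
proof
  assume es: "orthonormal_list b es"
  have "distinct es"
    unfolding distinct_conv_nth
    using es unfolding orthonormal_list_def by (metis zero_neq_one)
  with es show "distinct es \<and> orthonormal_set b (set es)"
    unfolding orthonormal_set_def orthonormal_list_def
    by (auto simp: in_set_conv_nth nth_eq_iff_index_eq)
next
  assume "distinct es \<and> orthonormal_set b (set es)"
  then show "orthonormal_list b es"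
    unfolding orthonormal_set_def orthonormal_list_def
    by (auto simp: nth_eq_iff_index_eq)
qed

locale inner_product_subspace =
  fixes V :: "'v::real_vector set" and b :: "'v \<Rightarrow> 'v \<Rightarrow> real"
  assumes subspace: "subspace V" and inner: "inner_product_on V b"
begin

lemma in_V [simp]:
  "0 \<in> V" "u \<in> V \<Longrightarrow> v \<in> V \<Longrightarrow> u + v \<in> V" "u \<in> V \<Longrightarrow> v \<in> V \<Longrightarrow> u - v \<in> V"
  "u \<in> V \<Longrightarrow> r *\<^sub>R u \<in> V"
  using subspace by (auto simp: subspace_0 subspace_add subspace_diff subspace_scale)

lemma combination_in_V: "B \<subseteq> V \<Longrightarrow> (\<Sum>x\<in>B. c x *\<^sub>R x) \<in> V"
  by (rule subspace_sum[OF subspace]) auto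

lemma comm: "u \<in> V \<Longrightarrow> v \<in> V \<Longrightarrow> b u v = b v u"
  using inner unfolding inner_product_on_def by blast

lemma pos: "v \<in> V \<Longrightarrow> v \<noteq> 0 \<Longrightarrow> b v v > 0"
  using inner unfolding inner_product_on_def by blast

lemma combine_left:
  "u \<in> V \<Longrightarrow> v \<in> V \<Longrightarrow> w \<in> V \<Longrightarrow> b (r *\<^sub>R u + s *\<^sub>R v) w = r * b u w + s * b v w"
  by (rule inner[unfolded inner_product_on_def, THEN conjunct1, rule_format])

lemma add_left: "u \<in> V \<Longrightarrow> v \<in> V \<Longrightarrow> w \<in> V \<Longrightarrow> b (u + v) w = b u w + b v w"
  using combine_left[of u v w 1 1] by simp

lemma diff_left: "u \<in> V \<Longrightarrow> v \<in> V \<Longrightarrow> w \<in> V \<Longrightarrow> b (u - v) w = b u w - b v w"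
  using combine_left[of u v w 1 "-1"] by simp

lemma scale_left: "u \<in> V \<Longrightarrow> w \<in> V \<Longrightarrow> b (r *\<^sub>R u) w = r * b u w"
  using combine_left[of u 0 w r 0] by simp

lemma zero_left: "w \<in> V \<Longrightarrow> b 0 w = 0"
  using scale_left[of 0 w 0] by simp

lemma combine_right:
  "u \<in> V \<Longrightarrow> v \<in> V \<Longrightarrow> w \<in> V \<Longrightarrow> b w (r *\<^sub>R u + s *\<^sub>R v) = r * b w u + s * b w v"
  using combine_left[of u v w r s] comm[of w] by simp

lemma sum_left:
  assumes "B \<subseteq> V" "w \<in> V"
  shows "b (\<Sum>x\<in>B. c x *\<^sub>R x) w = (\<Sum>x\<in>B. c x * b x w)"
  using assms(1)
proof (induction B rule: infinite_finite_induct)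
  case (insert x B)
  then show ?case
    using combination_in_V[of B c] assms(2) by (simp add: add_left scale_left)
qed (auto simp: zero_left assms(2))

lemma orthogonal_to_span:
  assumes "B \<subseteq> V" "n \<in> V" "\<forall>x\<in>B. b n x = 0" "v \<in> span B"
  shows "b n v = 0"
proof -
  have "subspace {v \<in> V. b n v = 0}"
    using assms(2) combine_right[of _ _ n 1 1] combine_right[of _ 0 n _ 0]
      comm[of n] zero_left[of n]
    by (auto simp: subspace_def)
  moreover have "B \<subseteq> {v \<in> V. b n v = 0}"
    using assms by auto
  ultimately show ?thesis
    using span_minimal[of B] assms(4) by blast
qed

text \<open>The subtracted sum is the orthogonal projection of \<open>v\<close> to the span of \<open>B\<close>.\<close>

lemma projection_residual_orthogonal:
  assumes "finite B" "B \<subseteq> V" "orthonormal_set b B" "v \<in> V" "x \<in> B"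
  shows "b (v - (\<Sum>y\<in>B. b v y *\<^sub>R y)) x = 0"
proof -
  have "(\<Sum>y\<in>B. b v y * b y x) = (\<Sum>y\<in>B. if y = x then b v y else 0)"
    using assms by (intro sum.cong) (auto simp: orthonormal_set_def)
  then have "(\<Sum>y\<in>B. b v y * b y x) = b v x"
    using assms by simp
  then show ?thesis
    using assms combination_in_V[of B "b v"] sum_left[of B x "b v"]
    by (auto simp: diff_left)
qed

text \<open>The residual of the projection lies in the span of \<open>B\<close> and is orthogonal to it, hence to itself.\<close>

lemma orthonormal_expansion:
  assumes "finite B" "B \<subseteq> V" "orthonormal_set b B" "v \<in> span B"
  shows "v = (\<Sum>y\<in>B. b v y *\<^sub>R y)"
proof (rule ccontr)
  define d where "d = v - (\<Sum>y\<in>B. b v y *\<^sub>R y)"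
  assume "\<not> ?thesis"
  then have "d \<noteq> 0" by (simp add: d_def)
  have v: "v \<in> V"
    using assms span_minimal[OF assms(2) subspace] by blast
  have dV: "d \<in> V"
    using v combination_in_V[OF assms(2)] by (simp add: d_def)
  have "d \<in> span B"
    unfolding d_def by (rule span_diff[OF assms(4)]) (auto intro: span_sum span_scale span_base)
  then have "b d d = 0"
    using orthogonal_to_span[OF assms(2) dV] projection_residual_orthogonal[OF assms(1-3) v]
    by (simp add: d_def)
  with pos[OF dV \<open>d \<noteq> 0\<close>] show False by simp
qed

lemma orthonormal_independent:
  assumes "B \<subseteq> V" "orthonormal_set b B"
  shows "independent B"
proof
  assume "dependent B"
  then obtain x where x: "x \<in> B" "x \<in> span (B - {x})"
    unfolding dependent_def by blast
  have "\<forall>y\<in>B - {x}. b x y = 0"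
    using x assms(2) by (auto simp: orthonormal_set_def)
  then have "b x x = 0"
    by (intro orthogonal_to_span[OF _ _ _ x(2)]) (use x(1) assms(1) in auto)
  then show False
    using x assms(2) by (auto simp: orthonormal_set_def)
qed

text \<open>Gram-Schmidt, run for a map that is an inner product only on \<open>V\<close>: the type of all
  tangent vectors carries no inner product of its own, since the metric varies with the base point.\<close>

lemma gram_schmidt:
  assumes "finite C" "C \<subseteq> V"
  shows "\<exists>B. finite B \<and> B \<subseteq> V \<and> orthonormal_set b B \<and> span B = span C"
  using assms
proof (induction C)
  case empty
  then show ?case by (intro exI[of _ "{}"]) (auto simp: orthonormal_set_def)
next
  case (insert c C)
  then obtain B where B: "finite B" "B \<subseteq> V" "orthonormal_set b B" "span B = span C"
    by auto
  have spanC: "span (insert c C) = span (insert c B)"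
    using B(4) by (simp add: span_insert)
  define n where "n = c - (\<Sum>y\<in>B. b c y *\<^sub>R y)"
  have nV: "n \<in> V"
    using insert.prems combination_in_V[OF B(2)] by (simp add: n_def)
  have "c - n \<in> span B"
    unfolding n_def by (auto intro: span_sum span_scale span_base)
  then have span_n: "span (insert c B) = span (insert n B)"
    by (rule eq_span_insert_eq)
  have n_orth: "\<forall>x\<in>B. b n x = 0"
    using projection_residual_orthogonal[OF B(1-3)] insert.prems by (simp add: n_def)
  show ?case
  proof (cases "n = 0")
    case True
    then have "span (insert c C) = span B"
      using spanC span_n by simp
    with B show ?thesis by blast
  next
    case False
    define u where "u = (1 / sqrt (b n n)) *\<^sub>R n"
    have bnn: "b n n > 0" using pos[OF nV False] .
    have uV: "u \<in> V" using nV by (simp add: u_def)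
    have bnu: "b n u = b n n / sqrt (b n n)"
      using nV comm[of n u] uV by (simp add: u_def scale_left)
    have "b u u = 1"
      using nV uV bnn bnu unfolding u_def by (simp add: scale_left)
    moreover have u_orth: "\<forall>x\<in>B. b u x = 0"
      using n_orth nV B(2) by (auto simp: u_def scale_left subset_iff)
    moreover have "\<forall>x\<in>B. b x u = 0"
      using u_orth uV B(2) comm[of _ u] by (metis subsetD)
    ultimately have "orthonormal_set b (insert u B)"
      using B(3) u_orth by (auto simp: orthonormal_set_def)
    moreover have "span (insert u B) = span (insert n B)"
    proof (rule span_eq[THEN iffD2], intro conjI)
      show "insert u B \<subseteq> span (insert n B)"
        by (auto simp: u_def intro: span_scale span_base)
      have "n = sqrt (b n n) *\<^sub>R u" using bnn by (simp add: u_def)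
      then have "n \<in> span (insert u B)"
        by (metis insertI1 span_base span_scale)
      then show "insert n B \<subseteq> span (insert u B)"
        by (auto intro: span_base)
    qed
    ultimately show ?thesis
      using B(1,2) uV spanC span_n by (intro exI[of _ "insert u B"]) auto
  qed
qed

end


section \<open>Alternating maps\<close>

lemma alternating_on_fix_first:
  assumes "alternating_on V (Suc k) f" "n \<in> V"
  shows "alternating_on V k (\<lambda>vs. f (n # vs))"
  unfolding alternating_on_def
proof (intro conjI allI impI ballI)
  fix vs i v w r s
  assume "set vs \<subseteq> V \<and> length vs = k \<and> i < k" "v \<in> V" "w \<in> V"
  then show "f (n # vs[i := r *\<^sub>R v + s *\<^sub>R w]) = r * f (n # vs[i := v]) + s * f (n # vs[i := w])"
    using assms(1)[unfolded alternating_on_def, THEN conjunct1, rule_format, of "n # vs" "Suc i" v w r s]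
      assms(2) by auto
next
  fix vs i j
  assume "set vs \<subseteq> V \<and> length vs = k \<and> i < j \<and> j < k \<and> vs ! i = vs ! j"
  then show "f (n # vs) = 0"
    using assms(1)[unfolded alternating_on_def, THEN conjunct2, rule_format, of "n # vs" "Suc i" "Suc j"]
      assms(2) by auto
qed

lemma alternating_on_combine:
  assumes "alternating_on V k f" "set vs \<subseteq> V" "length vs = k" "i < k" "v \<in> V" "w \<in> V"
  shows "f (vs[i := r *\<^sub>R v + s *\<^sub>R w]) = r * f (vs[i := v]) + s * f (vs[i := w])"
  using assms(2-) by (intro assms(1)[unfolded alternating_on_def, THEN conjunct1, rule_format]) auto

lemma alternating_on_repeated:
  assumes "alternating_on V k f" "set vs \<subseteq> V" "length vs = k" "i < k" "j < k" "i \<noteq> j"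
    "vs ! i = vs ! j"
  shows "f vs = 0"
  using assms(1)[unfolded alternating_on_def, THEN conjunct2] assms(2-) by (metis nat_neq_iff)

text \<open>Polarization: with \<open>x\<close> and \<open>y\<close> the two entries, expand the zero value at the list that has \<open>x + y\<close>
  in both places.\<close>

lemma alternating_on_swap:
  assumes f: "alternating_on V k f" and V: "subspace V"
    and vs: "set vs \<subseteq> V" "length vs = k" and ij: "i < k" "j < k" "i \<noteq> j"
  shows "f (vs[i := vs ! j, j := vs ! i]) = - f vs"
proof -
  define x y where "x = vs ! i" and "y = vs ! j"
  have xy: "x \<in> V" "y \<in> V"
    using vs ij by (auto simp: x_def y_def)
  then have "x + y \<in> V" using V by (simp add: subspace_add)
  define g where "g u v = f (vs[i := u, j := v])" for u v
  have add_snd: "g u (v + w) = g u v + g u w" if "u \<in> V" "v \<in> V" "w \<in> V" for u v w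
  proof -
    have "set (vs[i := u]) \<subseteq> V"
      using vs(1) that(1) set_update_subset_insert by fastforce
    then show ?thesis
      using alternating_on_combine[OF f, of "vs[i := u]" j v w 1 1] vs ij that
      by (simp add: g_def)
  qed
  have add_fst: "g (u + w) v = g u v + g w v" if "u \<in> V" "v \<in> V" "w \<in> V" for u v w
  proof -
    have "set (vs[j := v]) \<subseteq> V"
      using vs(1) that(2) set_update_subset_insert by fastforce
    then show ?thesis
      using alternating_on_combine[OF f, of "vs[j := v]" i u w 1 1] vs ij that
      by (simp add: g_def list_update_swap)
  qed
  have diag: "g u u = 0" if "u \<in> V" for u
  proof -
    have "set (vs[i := u, j := u]) \<subseteq> V"
      using vs(1) that set_update_subset_insert[of vs i u] set_update_subset_insert[of "vs[i := u]" j u]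
      by blast
    then show ?thesis
      using alternating_on_repeated[OF f, of "vs[i := u, j := u]" i j] vs ij
      by (simp add: g_def)
  qed
  have "g (x + y) (x + y) = g x x + g x y + (g y x + g y y)"
    using xy \<open>x + y \<in> V\<close> by (simp add: add_snd add_fst)
  then have "g y x = - g x y"
    using diag xy \<open>x + y \<in> V\<close> by simp
  then show ?thesis
    by (simp add: g_def x_def y_def)
qed

text \<open>Permutations are products of transpositions, each of which only changes the sign of the value.\<close>

lemma alternating_on_permuted_zero:
  assumes f: "alternating_on V k f" and V: "subspace V"
    and vs: "set vs \<subseteq> V" "length vs = k" and ws: "mset ws = mset vs" and zero: "f vs = 0"
  shows "f ws = 0"
proof -
  obtain p where p: "p permutes {..<length vs}" "permute_list p vs = ws"
    using mset_eq_permutation[OF ws] by blast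
  have "f (permute_list p vs) = 0"
    using finite_lessThan p(1)
  proof (induction rule: permutes_rev_induct)
    case id
    then show ?case using zero by simp
  next
    case (swap a b p)
    let ?us = "permute_list p vs"
    show ?case
    proof (cases "a = b")
      case False
      have set: "set ?us \<subseteq> V" 
        using swap vs(1) by simp
      have "permute_list (p \<circ> Transposition.transpose a b) vs = ?us[a := ?us ! b, b := ?us ! a]"
        using swap by (auto intro!: nth_equalityI simp: permute_list_def nth_list_update
            Transposition.transpose_def)
      then show ?thesis
        using alternating_on_swap[OF f V set, of a b] swap vs(2) False by (simp only: length_permute_list) simp
    qed (use swap in simp)
  qed
  with p(2) show ?thesis by simp
qed

text \<open>The entries are freed one after the other from \<open>B\<close> to its span: the vectors at which \<open>f\<close> vanishes in
  one place form a subspace. Lists with a repetition take the value zero anyway, so only the distinct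
  lists over \<open>B\<close> matter.\<close>

lemma alternating_on_zero_on_span:
  assumes f: "alternating_on V k f" and V: "subspace V" and B: "B \<subseteq> V"
    and zero: "\<And>es. set es \<subseteq> B \<Longrightarrow> length es = k \<Longrightarrow> distinct es \<Longrightarrow> f es = 0"
    and vs: "set vs \<subseteq> span B" "length vs = k"
  shows "f vs = 0"
proof -
  have spanB: "span B \<subseteq> V" by (rule span_minimal[OF B V])
  \<comment> \<open>The first \<open>j\<close> entries are arbitrary in the span, the others are still in \<open>B\<close>.\<close>
  have "f ws = 0" if "j \<le> k" "length ws = k" "set ws \<subseteq> span B" "\<forall>i<k. j \<le> i \<longrightarrow> ws ! i \<in> B" for j ws
    using that
  proof (induction j arbitrary: ws)
    case 0
    then have sub: "set ws \<subseteq> B" by (auto simp: in_set_conv_nth)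
    show ?case
    proof (cases "distinct ws")
      case True
      then show ?thesis using zero[of ws] 0 sub by simp
    next
      case False
      then obtain i j where "i < k" "j < k" "i \<noteq> j" "ws ! i = ws ! j"
        unfolding distinct_conv_nth using 0 by auto
      then show ?thesis
        using alternating_on_repeated[OF f, of ws i j] 0 sub B by auto
    qed
  next
    case (Suc j)
    let ?Z = "{v \<in> V. f (ws[j := v]) = 0}"
    have comb: "f (ws[j := r *\<^sub>R v + s *\<^sub>R w]) = r * f (ws[j := v]) + s * f (ws[j := w])"
      if "v \<in> V" "w \<in> V" for v w r s
      using alternating_on_combine[OF f, of ws j v w r s] Suc.prems spanB that by auto
    have "B \<subseteq> ?Z"
    proof
      fix v assume v: "v \<in> B"
      have "set (ws[j := v]) \<subseteq> span B"
        using Suc.prems(3) v set_update_subset_insert[of ws j v] span_base[OF v] by blast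
      then have "f (ws[j := v]) = 0"
        using Suc.prems v by (intro Suc.IH) (auto simp: nth_list_update)
      with v B show "v \<in> ?Z" by blast
    qed
    moreover have "subspace ?Z"
      unfolding subspace_def
    proof (intro conjI ballI allI)
      show "0 \<in> ?Z"
        using comb[of 0 0 0 0] V by (simp add: subspace_0)
      show "v + w \<in> ?Z" if "v \<in> ?Z" "w \<in> ?Z" for v w
        using comb[of v w 1 1] V that by (simp add: subspace_add)
      show "r *\<^sub>R v \<in> ?Z" if "v \<in> ?Z" for r v
        using comb[of v v r 0] V that by (simp add: subspace_scale)
    qed
    ultimately have "span B \<subseteq> ?Z" by (rule span_minimal)
    moreover have "ws ! j \<in> span B"
      using Suc.prems by auto
    ultimately show ?case by auto
  qed
  from this[of k vs] show ?thesis using vs by simp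
qed

text \<open>All distinct lists of length \<open>k\<close> over a basis with \<open>k\<close> members are permutations of each other, so a top degree
  map that vanishes on one basis vanishes identically. Applied to an orientation form, this shows
  that every orthonormal basis has a nonzero orientation sign.\<close>

lemma alternating_on_nonzero_on_basis:
  assumes f: "alternating_on V k f" "subspace V"
    and vs: "set vs \<subseteq> V" "length vs = k" "f vs \<noteq> 0"
    and es: "set es \<subseteq> V" "V \<subseteq> span (set es)" "length es = k" "distinct es"
  shows "f es \<noteq> 0"
proof
  assume zero: "f es = 0"
  have "f vs = 0"
  proof (rule alternating_on_zero_on_span[OF f es(1)])
    fix ws assume ws: "set ws \<subseteq> set es" "length ws = k" "distinct ws"
    have "set ws = set es"
      using ws es by (intro card_subset_eq) (auto simp: distinct_card)
    then have "mset ws = mset es"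
      using ws(3) es(4) set_eq_iff_mset_eq_distinct by blast
    then show "f ws = 0"
      using alternating_on_permuted_zero[OF f es(1,3)] zero by blast
  qed (use vs es in auto)
  with vs(3) show False by simp
qed


section \<open>Calibrated subspaces\<close>

context inner_product_subspace
begin

text \<open>The function \<open>\<theta> \<mapsto> cos \<theta> f (e, es) + sin \<theta> f (u, es)\<close>, where \<open>u = n / |n|\<close>, has maximal absolute value
  \<open>sqrt (f (e, es)\<^sup>2 + f (u, es)\<^sup>2) = sqrt (1 + f (u, es)\<^sup>2)\<close>, which the comass bounds by \<open>1\<close>. The proof evaluates \<open>f\<close>
  at the angle where the maximum is attained, so that no derivative in \<open>\<theta>\<close> is taken.\<close>

lemma comass_first_variation:
  assumes f: "alternating_on V (Suc (length es)) f"
    and comass: "\<And>us. set us \<subseteq> V \<Longrightarrow> length us = Suc (length es) \<Longrightarrow> orthonormal_list b us \<Longrightarrow> \<bar>f us\<bar> \<le> 1"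
    and es: "set (e # es) \<subseteq> V" "orthonormal_list b (e # es)" "\<bar>f (e # es)\<bar> = 1"
    and n: "n \<in> V" "\<forall>x\<in>set (e # es). b n x = 0"
  shows "f (n # es) = 0"
proof (cases "n = 0")
  case True
  then show ?thesis
    using alternating_on_combine[OF f, of "e # es" 0 0 0 0 0] es by auto
next
  case False
  define u where "u = (1 / sqrt (b n n)) *\<^sub>R n"
  define a where "a = f (u # es)"
  define N where "N = sqrt (1 + a\<^sup>2)"
  \<comment> \<open>The unit vector in the plane of \<open>e\<close> and \<open>u\<close> in the direction of \<open>(f (e, es), a)\<close>.\<close>
  define w where "w = (f (e # es) / N) *\<^sub>R e + (a / N) *\<^sub>R u"
  have bnn: "b n n > 0" using pos[OF n(1) False] .
  have N: "N > 0" "N\<^sup>2 = 1 + a\<^sup>2"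
    by (auto simp: N_def add_pos_nonneg)
  have V: "e \<in> V" "u \<in> V" "w \<in> V" "set es \<subseteq> V"
    using es n by (auto simp: u_def w_def)
  have comb: "f ((r *\<^sub>R v + s *\<^sub>R v') # es) = r * f (v # es) + s * f (v' # es)"
    if "v \<in> V" "v' \<in> V" for v v' r s
    using alternating_on_combine[OF f, of "e # es" 0 v v' r s] es that by auto
  have fe: "(f (e # es))\<^sup>2 = 1"
    using es(3) by (metis power2_abs one_power2)
  have "b u u = 1"
    using n(1) V(2) bnn comm[of n u] by (simp add: u_def scale_left)
  have u_orth: "b u x = 0" "b x u = 0" if "x \<in> set (e # es)" for x
    using that n V comm[of x u] by (auto simp: u_def scale_left)
  have orth: "distinct (e # es)" "orthonormal_set b (set (e # es))"
    using es(2) by (auto simp: orthonormal_list_iff)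
  have w_orth: "b w x = 0 \<and> b x w = 0" if "x \<in> set es" for x
  proof -
    have "x \<in> V" "x \<noteq> e" using that V orth(1) by auto
    then have "b w x = 0"
      using that V orth(2) u_orth(1)[of x] by (auto simp: w_def combine_left orthonormal_set_def)
    then show ?thesis using comm[of x w] \<open>x \<in> V\<close> V(3) by simp
  qed
  have "b w e = f (e # es) / N" "b w u = a / N"
    using V \<open>b u u = 1\<close> u_orth[of e] orth(2)
    by (auto simp: w_def combine_left orthonormal_set_def)
  then have "b w w = (f (e # es) / N) * (f (e # es) / N) + (a / N) * (a / N)"
    using combine_right[of e u w "f (e # es) / N" "a / N"] V by (simp add: w_def)
  also have "\<dots> = ((f (e # es))\<^sup>2 + a\<^sup>2) / N\<^sup>2"
    by (simp add: power2_eq_square add_divide_distrib)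
  finally have "b w w = 1"
    using N(1) fe by (simp flip: N(2))
  have "w \<notin> set es"
    using w_orth[of w] \<open>b w w = 1\<close> by auto
  then have "orthonormal_list b (w # es)"
    using orth w_orth \<open>b w w = 1\<close> by (auto simp: orthonormal_list_iff orthonormal_set_def)
  then have "\<bar>f (w # es)\<bar> \<le> 1"
    using comass[of "w # es"] V by simp
  moreover have "f (w # es) = ((f (e # es))\<^sup>2 + a\<^sup>2) / N"
    using V by (simp add: w_def comb a_def power2_eq_square add_divide_distrib)
  then have "f (w # es) = N"
    unfolding fe N(2)[symmetric] using N(1) by (simp add: power2_eq_square)
  ultimately have "N\<^sup>2 \<le> 1"
    using N(1) by (simp add: power_le_one)
  then have "a = 0" using N(2) by simp
  moreover have "a = (1 / sqrt (b n n)) * f (n # es)"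
    using comb[of n n "1 / sqrt (b n n)" 0] n(1) by (simp add: a_def u_def)
  ultimately show ?thesis using bnn by simp
qed

text \<open>With \<open>n\<close> fixed in the first place, \<open>f\<close> is alternating in the remaining \<open>l - 1\<close> places. A distinct list
  of \<open>l - 1\<close> members of \<open>B\<close> omits exactly one \<open>e \<in> B\<close>, and the first variation applies to
  the rotation of \<open>e\<close> towards \<open>n\<close>.\<close>

lemma calibrated_subspace_normal:
  assumes f: "alternating_on V l f"
    and comass: "\<And>us. set us \<subseteq> V \<Longrightarrow> length us = l \<Longrightarrow> orthonormal_list b us \<Longrightarrow> \<bar>f us\<bar> \<le> 1"
    and B: "B \<subseteq> V" "finite B" "card B = l" "orthonormal_set b B"
    and calibrated: "\<And>es. set es = B \<Longrightarrow> distinct es \<Longrightarrow> \<bar>f es\<bar> = 1"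
    and vs: "set vs \<subseteq> span B" "Suc (length vs) = l"
    and n: "n \<in> V" "\<forall>x\<in>B. b n x = 0"
  shows "f (n # vs) = 0"
proof (rule alternating_on_zero_on_span[of V "length vs" "\<lambda>vs. f (n # vs)" B])
  show "alternating_on V (length vs) (\<lambda>vs. f (n # vs))"
    using f vs(2) n(1) by (intro alternating_on_fix_first) auto
  fix es assume es: "set es \<subseteq> B" "length es = length vs" "distinct es"
  have "card (set es) < card B"
    using es vs(2) B(3) distinct_card[of es] by simp
  then obtain e where e: "e \<in> B" "e \<notin> set es"
    using B(2) es(1) by (metis psubset_imp_ex_mem psubsetI less_irrefl DiffE)
  have setB: "set (e # es) = B"
    using es e vs(2) B(2,3) distinct_card[of "e # es"] by (intro card_subset_eq) auto
  show "f (n # es) = 0"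
  proof (rule comass_first_variation[of es f e])
    show "alternating_on V (Suc (length es)) f" using f vs es by simp
    show "\<bar>f us\<bar> \<le> 1" if "set us \<subseteq> V" "length us = Suc (length es)" "orthonormal_list b us" for us
      using comass[OF that(1) _ that(3)] that es vs by simp
    show "orthonormal_list b (e # es)"
      using setB e es B(4) by (simp add: orthonormal_list_iff)
    show "\<bar>f (e # es)\<bar> = 1"
      using calibrated[OF setB] e es by simp
  qed (use setB B n in auto)
qed (use subspace B vs in auto)

text \<open>The sum \<open>w\<close> represents \<open>v \<mapsto> f (v, vs)\<close>, which vanishes on the normal part \<open>n\<close> of \<open>w\<close>. Hence
  \<open>b n n = b w n = f (n, vs) = 0\<close>, and \<open>w\<close> equals its projection to the span of \<open>B\<close>.\<close>

lemma calibrated_subspace_dual_vector: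
  assumes f: "alternating_on V l f"
    and comass: "\<And>us. set us \<subseteq> V \<Longrightarrow> length us = l \<Longrightarrow> orthonormal_list b us \<Longrightarrow> \<bar>f us\<bar> \<le> 1"
    and B: "B \<subseteq> V" "finite B" "card B = l" "orthonormal_set b B"
    and calibrated: "\<And>es. set es = B \<Longrightarrow> distinct es \<Longrightarrow> \<bar>f es\<bar> = 1"
    and vs: "set vs \<subseteq> span B" "Suc (length vs) = l"
    and E: "orthonormal_basis V b es"
  shows "(\<Sum>e\<leftarrow>es. f (e # vs) *\<^sub>R e) \<in> span B"
proof -
  have es: "distinct es" "orthonormal_set b (set es)" "set es \<subseteq> V" "V \<subseteq> span (set es)"
    using E by (auto simp: orthonormal_basis_def orthonormal_list_iff)
  define w where "w = (\<Sum>e\<in>set es. f (e # vs) *\<^sub>R e)"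
  define n where "n = w - (\<Sum>y\<in>B. b w y *\<^sub>R y)"
  have w: "w \<in> V" unfolding w_def using es(3) by (rule combination_in_V)
  have projV: "(\<Sum>y\<in>B. b w y *\<^sub>R y) \<in> V" by (rule combination_in_V[OF B(1)])
  have n: "n \<in> V" using w projV by (simp add: n_def)
  have n_orth: "\<forall>x\<in>B. b n x = 0"
    using projection_residual_orthogonal[OF B(2,1,4) w] by (simp add: n_def)
  have vsV: "set vs \<subseteq> V"
    using vs(1) span_minimal[OF B(1) subspace] by blast
  have comb: "f ((r *\<^sub>R v + s *\<^sub>R v') # vs) = r * f (v # vs) + s * f (v' # vs)"
    if "v \<in> V" "v' \<in> V" for v v' r s
    using alternating_on_combine[OF f, of "v # vs" 0 v v' r s] vsV vs(2) that by auto
  have f0: "f (0 # vs) = 0"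
    using comb[of 0 0 0 0] by simp
  have f_sum: "f ((\<Sum>x\<in>C. c x *\<^sub>R x) # vs) = (\<Sum>x\<in>C. c x * f (x # vs))"
    if "C \<subseteq> V" for C c
    using that
  proof (induction C rule: infinite_finite_induct)
    case (insert x C)
    then show ?case
      using comb[of x "\<Sum>x\<in>C. c x *\<^sub>R x" "c x" 1] combination_in_V[of C c] by simp
  qed (auto simp: f0)
  have "b w n = (\<Sum>e\<in>set es. f (e # vs) * b e n)"
    unfolding w_def by (rule sum_left[OF es(3) n])
  also have "\<dots> = (\<Sum>e\<in>set es. b n e * f (e # vs))"
    using es(3) comm[OF n] by (intro sum.cong) auto
  also have "\<dots> = f ((\<Sum>e\<in>set es. b n e *\<^sub>R e) # vs)"
    by (rule f_sum[OF es(3), symmetric])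
  also have "(\<Sum>e\<in>set es. b n e *\<^sub>R e) = n"
    using orthonormal_expansion[of "set es" n] es n by auto
  also have "f (n # vs) = 0"
    by (rule calibrated_subspace_normal[OF f comass B calibrated vs n n_orth])
  finally have "b w n = 0" .
  moreover have proj: "(\<Sum>y\<in>B. b w y *\<^sub>R y) \<in> span B"
    by (auto intro: span_sum span_scale span_base)
  then have "b n (\<Sum>y\<in>B. b w y *\<^sub>R y) = 0"
    by (rule orthogonal_to_span[OF B(1) n n_orth])
  ultimately have "b n n = 0"
    using diff_left[OF w projV n, folded n_def] comm[OF n projV] by simp
  then have "n = 0" using pos[OF n] by fastforce
  then have "w \<in> span B" using proj by (simp add: n_def)
  then show ?thesis
    using es(1) by (simp add: w_def sum_list_distinct_conv_sum_set)
qed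

end


section \<open>Tangent spaces in coordinates\<close>

lemma is_chart_inj_on: "is_chart X c \<Longrightarrow> inj_on (snd c) (fst c)"
  unfolding is_chart_def homeomorphic_map_def
  by (metis openin_subset topspace_subtopology_subset)

lemma chart_inv_inverse:
  "is_chart X c \<Longrightarrow> x \<in> fst c \<Longrightarrow> chart_inv c (snd c x) = x"
  unfolding chart_inv_def by (rule inv_into_f_f[OF is_chart_inj_on])

lemma open_chart_image_subset:
  assumes c: "is_chart X c" and U: "openin X U" "U \<subseteq> fst c"
  shows "open (snd c ` U)"
proof -
  have "openin (subtopology X (fst c)) U"
    using c U by (simp add: is_chart_def openin_open_subtopology)
  then have "openin (top_of_set (chart_image c)) (snd c ` U)"
    using c homeomorphic_imp_open_map unfolding is_chart_def open_map_def by blast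
  then show ?thesis
    using c openin_open_trans unfolding is_chart_def by blast
qed

context
  fixes X :: "'a topology" and A :: "('a, 'e::euclidean_space) chart set"
  assumes M: "smooth_manifold X A"
begin

lemma atlas_chart: "c \<in> A \<Longrightarrow> is_chart X c"
  using M unfolding smooth_manifold_def by blast

lemma atlas_open: "c \<in> A \<Longrightarrow> openin X (fst c)"
  using atlas_chart unfolding is_chart_def by blast

lemma transition_has_derivative:
  assumes "c \<in> A" "d \<in> A" "x \<in> fst c" "x \<in> fst d"
  shows "(transition c d has_derivative frechet_derivative (transition c d) (at (snd c x))) (at (snd c x))"
proof -
  have "compatible_charts c d"
    using M assms unfolding smooth_manifold_def by blast
  then have "differentiable_upto (Suc 0) (snd c ` (fst c \<inter> fst d)) (transition c d)"
    unfolding compatible_charts_def smooth_on_def by blast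
  then have "transition c d differentiable (at (snd c x))"
    using assms by auto
  then show ?thesis by (simp add: frechet_derivative_works)
qed

lemma transition_apply:
  "c \<in> A \<Longrightarrow> x \<in> fst c \<Longrightarrow> transition c d (snd c x) = snd d x"
  by (simp add: transition_def chart_inv_inverse[OF atlas_chart])

lemma linear_transition_derivative:
  assumes "c \<in> A" "d \<in> A" "x \<in> fst c" "x \<in> fst d"
  shows "linear (frechet_derivative (transition c d) (at (snd c x)))"
  using transition_has_derivative[OF assms] by (rule has_derivative_linear)

text \<open>The chain rule for \<open>transition d e \<circ> transition c d\<close>, which agrees with \<open>transition c e\<close> only on
  the coordinates of the common domain; this set is open, so the derivatives agree.\<close>

lemma transition_derivative_compose:
  assumes cde: "c \<in> A" "d \<in> A" "e \<in> A" "x \<in> fst c" "x \<in> fst d" "x \<in> fst e"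
  shows "frechet_derivative (transition c e) (at (snd c x)) u =
    frechet_derivative (transition d e) (at (snd d x)) (frechet_derivative (transition c d) (at (snd c x)) u)"
proof -
  let ?U = "fst c \<inter> fst d \<inter> fst e"
  have "openin X ?U" using cde by (intro openin_Int atlas_open)
  then have "open (snd c ` ?U)"
    using open_chart_image_subset[OF atlas_chart[OF cde(1)]] by auto
  moreover have "snd c x \<in> snd c ` ?U" using cde by auto
  moreover have "(transition d e \<circ> transition c d) p = transition c e p" if "p \<in> snd c ` ?U" for p
    using that cde by (auto simp: transition_apply)
  moreover have "(transition d e \<circ> transition c d has_derivative
      frechet_derivative (transition d e) (at (snd d x)) \<circ> frechet_derivative (transition c d) (at (snd c x)))
      (at (snd c x))"
    using transition_has_derivative[OF cde(1,2,4,5)] transition_has_derivative[OF cde(2,3,5,6)] cde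
    by (intro diff_chain_at) (simp_all add: transition_apply)
  ultimately have "(transition c e has_derivative
      frechet_derivative (transition d e) (at (snd d x)) \<circ> frechet_derivative (transition c d) (at (snd c x)))
      (at (snd c x))"
    using has_derivative_transform_within_open by blast
  then have "frechet_derivative (transition d e) (at (snd d x)) \<circ> frechet_derivative (transition c d) (at (snd c x))
      = frechet_derivative (transition c e) (at (snd c x))"
    by (rule frechet_derivative_at)
  then show ?thesis by (metis comp_apply)
qed

lemma transition_self_derivative:
  assumes "c \<in> A" "x \<in> fst c"
  shows "frechet_derivative (transition c c) (at (snd c x)) u = u"
proof -
  have "open (snd c ` fst c)"
    using open_chart_image_subset[OF atlas_chart[OF assms(1)] atlas_open[OF assms(1)]] by simp
  then have "(transition c c has_derivative (\<lambda>u. u)) (at (snd c x))"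
    using assms
    by (intro has_derivative_transform_within_open[OF has_derivative_ident]) (auto simp: transition_apply)
  then show ?thesis
    using frechet_derivative_at by metis
qed

lemma tangent_spaceI:
  assumes "\<And>c d. c \<in> A \<Longrightarrow> d \<in> A \<Longrightarrow> x \<in> fst c \<Longrightarrow> x \<in> fst d \<Longrightarrow>
      components v d = frechet_derivative (transition c d) (at (snd c x)) (components v c)"
    and "\<And>c. \<not> (c \<in> A \<and> x \<in> fst c) \<Longrightarrow> components v c = 0"
  shows "v \<in> tangent_space A x"
  unfolding tangent_space_def mem_Collect_eq
  by (intro conjI ballI allI impI; (elim conjE)?; rule assms)

lemma tangent_spaceD:
  assumes "v \<in> tangent_space A x" "c \<in> A" "d \<in> A" "x \<in> fst c" "x \<in> fst d"
  shows "frechet_derivative (transition c d) (at (snd c x)) (components v c) = components v d"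
  using assms(1)[unfolded tangent_space_def mem_Collect_eq, THEN conjunct1, rule_format, of c d]
    assms(2-) by simp

lemma tangent_space_outside:
  assumes "v \<in> tangent_space A x" "\<not> (c \<in> A \<and> x \<in> fst c)"
  shows "components v c = 0"
  by (rule assms(1)[unfolded tangent_space_def mem_Collect_eq, THEN conjunct2, rule_format, OF assms(2)])

lemma subspace_tangent_space: "subspace (tangent_space A x)"
proof (rule subspaceI)
  show "0 \<in> tangent_space A x"
    by (rule tangent_spaceI)
      (simp_all add: zero_tvec.rep_eq linear_0[OF linear_transition_derivative])
  show "u + v \<in> tangent_space A x" if "u \<in> tangent_space A x" "v \<in> tangent_space A x" for u v
    using that
    by (intro tangent_spaceI)
      (simp_all add: plus_tvec.rep_eq linear_add[OF linear_transition_derivative]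
        tangent_spaceD tangent_space_outside)
  show "r *\<^sub>R v \<in> tangent_space A x" if "v \<in> tangent_space A x" for r v
    using that
    by (intro tangent_spaceI)
      (simp_all add: scaleR_tvec.rep_eq linear_scale[OF linear_transition_derivative]
        tangent_spaceD tangent_space_outside)
qed

lemma components_coord_vec:
  assumes "c \<in> A" "x \<in> fst c"
  shows "components (coord_vec A c x u) c = u"
  using assms by (simp add: coord_vec_def Tvec_inverse transition_self_derivative)

text \<open>The cocycle identity of the derivatives makes the components of \<open>coord_vec\<close> compatible.\<close>

lemma coord_vec_in_tangent_space:
  assumes "c \<in> A" "x \<in> fst c"
  shows "coord_vec A c x u \<in> tangent_space A x"
  using assms
  by (intro tangent_spaceI)
    (simp_all only: coord_vec_def Tvec_inverse UNIV_I transition_derivative_compose[symmetric] simp_thms if_True if_False)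

lemma coord_vec_components:
  assumes "c \<in> A" "x \<in> fst c" "v \<in> tangent_space A x"
  shows "coord_vec A c x (components v c) = v"
proof -
  have "components (coord_vec A c x (components v c)) d = components v d" for d
    using assms tangent_spaceD[OF assms(3,1), of d] tangent_space_outside[OF assms(3), of d]
    by (cases "d \<in> A \<and> x \<in> fst d") (simp_all only: coord_vec_def Tvec_inverse UNIV_I simp_thms if_True if_False)
  then have "components (coord_vec A c x (components v c)) = components v"
    by (rule ext)
  then show ?thesis by (simp add: components_inject)
qed

lemma linear_coord_vec:
  assumes "c \<in> A" "x \<in> fst c"
  shows "linear (coord_vec A c x)"
proof (rule linearI)
  fix u w :: 'e and r :: real
  have "components (coord_vec A c x (u + w)) d = components (coord_vec A c x u + coord_vec A c x w) d" for d
    using assms by (simp add: coord_vec_def Tvec_inverse plus_tvec.rep_eq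
        linear_add[OF linear_transition_derivative])
  then show "coord_vec A c x (u + w) = coord_vec A c x u + coord_vec A c x w"
    using components_inject by blast
  have "components (coord_vec A c x (r *\<^sub>R u)) d = components (r *\<^sub>R coord_vec A c x u) d" for d
    using assms by (simp add: coord_vec_def Tvec_inverse scaleR_tvec.rep_eq
        linear_scale[OF linear_transition_derivative])
  then show "coord_vec A c x (r *\<^sub>R u) = r *\<^sub>R coord_vec A c x u"
    using components_inject by blast
qed

lemma inj_coord_vec: "c \<in> A \<Longrightarrow> x \<in> fst c \<Longrightarrow> inj (coord_vec A c x)"
  by (metis components_coord_vec injI)

lemma tangent_space_eq_image:
  assumes "c \<in> A" "x \<in> fst c"
  shows "tangent_space A x = coord_vec A c x ` UNIV"
  using coord_vec_in_tangent_space[OF assms] coord_vec_components[OF assms]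
  by (metis UNIV_I image_eqI subsetI subset_antisym image_subsetI)

text \<open>A short segment from the coordinates of \<open>x\<close> in a direction of \<open>S\<close> stays in \<open>L\<close>, so the transition map
  sends it into \<open>S'\<close>. The derivative is a limit of difference quotients in \<open>S'\<close>, which is closed. As a
  consequence, tangency to \<open>L\<close> can be tested in any one slice chart.\<close>

lemma slice_transition_derivative:
  assumes c: "slice_chart A L c S" "x \<in> fst c" and d: "slice_chart A L d S'" "x \<in> fst d"
    and x: "x \<in> L" and s: "s \<in> S"
  shows "frechet_derivative (transition c d) (at (snd c x)) s \<in> S'"
proof -
  let ?D = "frechet_derivative (transition c d) (at (snd c x))"
  let ?p = "snd c x"
  have cA: "c \<in> A" "subspace S" "snd c ` (fst c \<inter> L) = chart_image c \<inter> S"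
    and dA: "d \<in> A" "subspace S'" "snd d ` (fst d \<inter> L) = chart_image d \<inter> S'"
    using c d unfolding slice_chart_def by auto
  let ?U = "snd c ` (fst c \<inter> fst d)"
  have "openin X (fst c \<inter> fst d)" using cA dA by (intro openin_Int atlas_open)
  then have "open ?U"
    using open_chart_image_subset[OF atlas_chart[OF cA(1)]] by auto
  have pS: "?p \<in> S" "snd d x \<in> S'" using cA(3) dA(3) c d x by auto
  have in_S': "transition c d q \<in> S'" if q: "q \<in> ?U" "q \<in> S" for q
  proof -
    obtain y where y: "y \<in> fst c" "y \<in> fst d" "q = snd c y" using q(1) by blast
    have "q \<in> snd c ` (fst c \<inter> L)"
      using q y cA(3) by (auto simp: chart_image_def)
    then obtain z where "z \<in> fst c" "z \<in> L" "q = snd c z" by blast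
    then have "y \<in> L"
      using y is_chart_inj_on[OF atlas_chart[OF cA(1)]] by (metis inj_onD)
    then have "snd d y \<in> S'" using y dA(3) by auto
    then show ?thesis using y cA(1) by (simp add: transition_apply)
  qed
  define \<gamma> where "\<gamma> t = ?p + t *\<^sub>R s" for t :: real
  have "((\<lambda>t. transition c d (\<gamma> t)) has_derivative (\<lambda>t. ?D (t *\<^sub>R s))) (at 0)"
  proof (rule has_derivative_compose[of \<gamma> "\<lambda>t. t *\<^sub>R s" 0 UNIV])
    show "(\<gamma> has_derivative (\<lambda>t. t *\<^sub>R s)) (at 0)"
      unfolding \<gamma>_def by (auto intro!: derivative_eq_intros)
    show "(transition c d has_derivative ?D) (at (\<gamma> 0))"
      using transition_has_derivative[OF cA(1) dA(1) c(2) d(2)] by (simp add: \<gamma>_def)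
  qed
  \<comment> \<open>For \<open>t > 0\<close> the norm in the definition of the derivative is \<open>t\<close> itself, so that it describes
    the limit of the difference quotients.\<close>
  then have "((\<lambda>t. transition c d (\<gamma> t)) has_derivative (\<lambda>t. ?D (t *\<^sub>R s))) (at_right 0)"
    by (rule has_derivative_at_withinI)
  then have "((\<lambda>t. (1 / norm (t - 0)) *\<^sub>R
      (transition c d (\<gamma> t) - (transition c d (\<gamma> 0) + ?D ((t - 0) *\<^sub>R s)))) \<longlongrightarrow> 0) (at_right 0)"
    unfolding has_derivative_within by (rule conjunct2)
  then have "((\<lambda>t. (1 / norm (t - 0)) *\<^sub>R
      (transition c d (\<gamma> t) - (transition c d (\<gamma> 0) + ?D ((t - 0) *\<^sub>R s))) + ?D s) \<longlongrightarrow> 0 + ?D s) (at_right 0)"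
    by (intro tendsto_add tendsto_const)
  moreover have "\<forall>\<^sub>F t in at_right 0. (1 / norm (t - 0)) *\<^sub>R
      (transition c d (\<gamma> t) - (transition c d (\<gamma> 0) + ?D ((t - 0) *\<^sub>R s))) + ?D s =
      (transition c d (\<gamma> t) - transition c d (\<gamma> 0)) /\<^sub>R t"
    using eventually_at_right_less[of "0::real"]
  proof eventually_elim
    case (elim t)
    then show ?case
      by (simp add: linear_scale[OF linear_transition_derivative[OF cA(1) dA(1) c(2) d(2)]]
          scaleR_diff_right scaleR_add_right divide_inverse)
  qed
  ultimately have "((\<lambda>t. (transition c d (\<gamma> t) - transition c d (\<gamma> 0)) /\<^sub>R t) \<longlongrightarrow> 0 + ?D s) (at_right 0)"
    by (rule Lim_transform_eventually)
  moreover have "\<forall>\<^sub>F t in at_right 0. (transition c d (\<gamma> t) - transition c d (\<gamma> 0)) /\<^sub>R t \<in> S'"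
  proof -
    have "(\<gamma> \<longlongrightarrow> ?p) (at_right 0)"
      unfolding \<gamma>_def by (auto intro!: tendsto_eq_intros)
    then have "\<forall>\<^sub>F t in at_right 0. \<gamma> t \<in> ?U"
      using \<open>open ?U\<close> c(2) d(2) by (intro topological_tendstoD) auto
    then show ?thesis
    proof eventually_elim
      case (elim t)
      have "\<gamma> t \<in> S"
        unfolding \<gamma>_def using cA(2) pS s by (auto intro: subspace_add subspace_scale)
      moreover have "transition c d (\<gamma> 0) \<in> S'"
        using pS cA(1) c(2) by (simp add: \<gamma>_def transition_apply)
      ultimately show ?case
        using in_S'[OF elim] dA(2) by (auto intro: subspace_diff subspace_scale)
    qed
  qed
  ultimately show ?thesis
    using closed_subspace[OF dA(2)] by (intro Lim_in_closed_set[of S' _ "at_right 0"]) auto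
qed

text \<open>The existential over slice charts in the definition of \<open>T\<^sub>xL\<close> is replaced by one fixed slice chart;
  this is what makes \<open>T\<^sub>xL\<close> a subspace of dimension \<open>dim S\<close>.\<close>

lemma sub_tangent_space_eq_image:
  assumes c: "slice_chart A L c S" "x \<in> fst c" and x: "x \<in> L"
  shows "sub_tangent_space A L x = coord_vec A c x ` S"
proof
  have cA: "c \<in> A" using c unfolding slice_chart_def by auto
  show "coord_vec A c x ` S \<subseteq> sub_tangent_space A L x"
    using c cA components_coord_vec[OF cA c(2)] coord_vec_in_tangent_space[OF cA c(2)]
    unfolding sub_tangent_space_def by fastforce
  show "sub_tangent_space A L x \<subseteq> coord_vec A c x ` S"
  proof
    fix v assume "v \<in> sub_tangent_space A L x"
    then obtain d S' where d: "slice_chart A L d S'" "x \<in> fst d" "components v d \<in> S'"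
      and v: "v \<in> tangent_space A x"
      unfolding sub_tangent_space_def by auto
    have "d \<in> A" using d(1) unfolding slice_chart_def by simp
    then have "components v c = frechet_derivative (transition d c) (at (snd d x)) (components v d)"
      using tangent_spaceD[OF v _ cA d(2) c(2)] by simp
    then have "components v c \<in> S"
      using slice_transition_derivative[OF d(1,2) c x d(3)] by simp
    then show "v \<in> coord_vec A c x ` S"
      using coord_vec_components[OF cA c(2) v] by (metis imageI)
  qed
qed

lemma tangent_space_finite_span:
  assumes "x \<in> topspace X"
  shows "\<exists>C. finite C \<and> span C = tangent_space A x"
proof -
  have "topspace X = (\<Union>c\<in>A. fst c)"
    using M unfolding smooth_manifold_def by (elim conjE)
  then obtain c where c: "c \<in> A" "x \<in> fst c"
    using assms by blast
  have "span (coord_vec A c x ` Basis) = tangent_space A x"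
    using linear_span_image[OF linear_coord_vec[OF c], of Basis] tangent_space_eq_image[OF c]
    by simp
  then show ?thesis by (intro exI[of _ "coord_vec A c x ` Basis"]) auto
qed

lemma sub_tangent_space_basis:
  assumes "submanifold X A l L" "x \<in> L"
  shows "\<exists>C. finite C \<and> independent C \<and> card C = l \<and> span C = sub_tangent_space A L x"
proof -
  obtain c S where c: "slice_chart A L c S" "x \<in> fst c" and S: "dim S = l"
    using assms(1)[unfolded submanifold_def, THEN conjunct2, THEN bspec, OF assms(2)] by blast
  have cA: "c \<in> A" "subspace S" using c unfolding slice_chart_def by simp_all
  obtain B where B: "B \<subseteq> S" "independent B" "S \<subseteq> span B" "card B = dim S"
    using basis_exists[of S] by metis
  have "span B = S" using B cA(2) by (simp add: span_subspace)
  then have "span (coord_vec A c x ` B) = sub_tangent_space A L x"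
    using linear_span_image[OF linear_coord_vec[OF cA(1) c(2)], of B]
      sub_tangent_space_eq_image[OF c assms(2)] by simp
  moreover have "independent (coord_vec A c x ` B)"
    using linear_independent_injective_image[OF linear_coord_vec[OF cA(1) c(2)] B(2)]
      inj_coord_vec[OF cA(1) c(2)] by (meson inj_on_subset subset_UNIV)
  moreover have "card (coord_vec A c x ` B) = l"
    using B(4) S inj_coord_vec[OF cA(1) c(2)] by (metis card_image inj_on_subset subset_UNIV)
  moreover have "finite B" using B(2) independent_imp_finite by blast
  ultimately show ?thesis by (intro exI[of _ "coord_vec A c x ` B"]) auto
qed

end


section \<open>The normal part on a calibrated submanifold\<close>

lemma comass_bound:
  assumes "comass X A g k \<phi> = 1" "x \<in> topspace X"
    "set es \<subseteq> tangent_space A x" "length es = k" "orthonormal_list (g x) es"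
  shows "\<bar>\<phi> x es\<bar> \<le> 1"
proof -
  have "ennreal \<bar>\<phi> x es\<bar> \<le> comass X A g k \<phi>"
    unfolding comass_def using assms by (intro SUP_upper2[of x] SUP_upper2[of es]) auto
  then show ?thesis using assms(1) by simp
qed

theorem lemma3p1:
  fixes X :: "'a topology"
    and A :: "('a, 'e::euclidean_space) chart set"
    and g :: "('a, 'e) metric"
    and l :: nat
    and \<phi> :: "('a, 'e) form"
    and L :: "'a set"
    and \<mu> :: "('a, 'e) form"
  assumes "smooth_manifold X A"
    and "riemannian_metric X A g"
    and "calibration X A g l \<phi>"
    and "calibrated_submanifold X A g l \<phi> L \<mu>"
  shows "\<forall>x\<in>L. \<forall>vs. set vs \<subseteq> sub_tangent_space A L x \<and> Suc (length vs) = l \<longrightarrow>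
           normal_pr A L x (hat_form A g \<phi> x vs) = normal_zero A L x"
proof (intro ballI allI impI, elim conjE)
  fix x vs
  assume x: "x \<in> L" and vs: "set vs \<subseteq> sub_tangent_space A L x" "Suc (length vs) = l"
  let ?V = "tangent_space A x" and ?T = "sub_tangent_space A L x"
  have L: "submanifold X A l L" "orientation_form A l L \<mu>" "riemannian_volume_form A g l L \<mu> \<phi>"
    using assms(4) by (auto simp: calibrated_submanifold_def)
  have xX: "x \<in> topspace X" using L(1) x by (auto simp: submanifold_def)
  have \<phi>: "alternating_on ?V l (\<phi> x)" and comass: "comass X A g l \<phi> = 1"
    using assms(3) xX by (auto simp: calibration_def differential_form_def)
  interpret inner_product_subspace ?V "g x"
    using subspace_tangent_space[OF assms(1)] assms(2) xX
    by unfold_locales (auto simp: riemannian_metric_def)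
  obtain C where C: "finite C" "span C = ?V"
    using tangent_space_finite_span[OF assms(1) xX] by blast
  then obtain E where E: "finite E" "E \<subseteq> ?V" "orthonormal_set (g x) E" "span E = ?V"
    using gram_schmidt[of C] span_superset[of C] by auto
  obtain es0 where "set es0 = E" "distinct es0"
    using finite_distinct_list[OF E(1)] by blast
  then have "\<exists>es. orthonormal_basis ?V (g x) es"
    using E by (intro exI[of _ es0]) (auto simp: orthonormal_basis_def orthonormal_list_iff)
  \<comment> \<open>Existence makes the choice in \<open>hat_form\<close> an orthonormal basis.\<close>
  then have hat_basis: "orthonormal_basis ?V (g x) (SOME es. orthonormal_basis ?V (g x) es)"
    by (rule someI_ex)
  obtain D where D: "finite D" "independent D" "card D = l" "span D = ?T"
    using sub_tangent_space_basis[OF assms(1) L(1) x] by blast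
  have "?T \<subseteq> ?V" by (auto simp: sub_tangent_space_def)
  then obtain B where B: "finite B" "B \<subseteq> ?V" "orthonormal_set (g x) B" "span B = ?T"
    using gram_schmidt[of D] D span_superset[of D] by auto
  have "card B = l"
    using D B orthonormal_independent[OF B(2,3)] by (metis dim_eq_card)
  have T: "subspace ?T" using B(4) subspace_span by metis
  have "\<bar>\<phi> x es\<bar> = 1" if es: "set es = B" "distinct es" for es
  proof -
    obtain ws where ws: "set ws \<subseteq> ?T" "length ws = l" "\<mu> x ws \<noteq> 0"
      and \<mu>: "alternating_on ?T l (\<mu> x)"
      using L(2) x unfolding orientation_form_def by blast
    have "set es \<subseteq> ?T" using es B(4) span_superset by blast
    then have "\<mu> x es \<noteq> 0"
      using es B \<open>card B = l\<close> distinct_card[of es]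
      by (intro alternating_on_nonzero_on_basis[OF \<mu> T ws]) auto
    moreover have "\<phi> x es = sgn (\<mu> x es)"
      using L(3) x es B \<open>set es \<subseteq> ?T\<close> unfolding riemannian_volume_form_def
      by (auto simp: orthonormal_basis_def orthonormal_list_iff)
    ultimately show ?thesis by (simp add: abs_sgn_eq)
  qed
  then have "hat_form A g \<phi> x vs \<in> span B"
    unfolding hat_form_def Let_def
    using vs B \<open>card B = l\<close> hat_basis comass_bound[OF comass xX]
    by (intro calibrated_subspace_dual_vector[OF \<phi>]) auto
  then have hat: "hat_form A g \<phi> x vs \<in> ?T" using B(4) by simp
  have "(+) v ` ?T = ?T" if "v \<in> ?T" for v
  proof
    show "(+) v ` ?T \<subseteq> ?T" using that T by (auto intro: subspace_add)
    have "w = v + (w - v)" "w - v \<in> ?T" if "w \<in> ?T" for w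
      using \<open>v \<in> ?T\<close> that T by (auto intro: subspace_diff)
    then show "?T \<subseteq> (+) v ` ?T" by blast
  qed
  from this[OF hat] show "normal_pr A L x (hat_form A g \<phi> x vs) = normal_zero A L x"
    by (simp add: normal_pr_def normal_zero_def)
qed

end
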